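(* The number of edges in the origami flip graph $\mathrm{OFG}(A_{2n})$ is $$\frac{(n+1)(3n-2)}{2n-1}\binom{2n}{n-1}.$$
   Context: $A_{2n}$ is the crease pattern with a single interior vertex of degree $2n$, creases $e_1,\dots,e_{2n}$ in cyclic order, all angles between consecutive creases equal to $\pi/n$, and faces $\alpha_1,\dots,\alpha_{2n}$, where $\alpha_i$ is the face between $e_i$ and $e_{i+1}$ (indices taken cyclically). A mountain-valley (MV) assignment is a function $\mu:\{e_1,\dots,e_{2n}\}\to\{-1,1\}$ ($1$ = mountain, $-1$ = valley). It is valid if it can be used to fold the paper flat without self-intersection; for $A_{2n}$ this is known to be equivalent to $\sum_{i=1}^{2n}\mu(e_i)=\pm 2$. Flipping a face $\alpha_i$ means changing the sign of $\mu$ on exactly the two creases $e_i,e_{i+1}$ bordering $\alpha_i$; the resulting MV assignment is denoted $\mu_{\alpha_i}$. The origami flip graph $\mathrm{OFG}(A_{2n})$ is the graph whose vertices are all valid MV assignments of $A_{2n}$, where two vertices $\mu$ and $\nu$ are connected by an edge if and only if there exists a face $\alpha_i$ of $A_{2n}$ such that flipping $\alpha_i$ changes $\mu$ to $\nu$ (and vice versa), i.e. $\nu=\mu_{\alpha_i}$.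
   Formalization: The formal theorem assumes n ≥ 2; for n = 1 the claim fails, since both faces of A_2 give the same flip, so the flip graph has 2 vertices and 1 edge while the formula gives 2. *)

theory Defs
  imports Complex_Main "HOL-Library.FuncSet"
begin

text \<open>
  A crease pattern with a single interior vertex. Creases and faces are both indexed cyclically by
  \<open>0, \<dots>, N - 1\<close>; face \<open>i\<close> lies between the creases \<open>i\<close> and \<open>i + 1 mod N\<close>, and
  \<open>face_angle C i\<close> is its angle at the vertex. So crease \<open>c\<close> borders the faces \<open>c - 1 mod N\<close>
  and \<open>c\<close>.
\<close>

record vertex_cp =
  num_creases :: nat
  face_angle :: "nat \<Rightarrow> real"

definition next_crease :: "vertex_cp \<Rightarrow> nat \<Rightarrow> nat" where
  "next_crease C i = Suc i mod num_creases C"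

definition face_before :: "vertex_cp \<Rightarrow> nat \<Rightarrow> nat" where
  "face_before C c = (c + num_creases C - 1) mod num_creases C"

definition A_cp :: "nat \<Rightarrow> vertex_cp" where
  "A_cp m = \<lparr>num_creases = m, face_angle = (\<lambda>_. 2 * pi / real m)\<rparr>"

text \<open>
  Mountain-valley assignments: \<open>1\<close> is a mountain, \<open>-1\<close> a valley.
\<close>

definition MV_assignments :: "vertex_cp \<Rightarrow> (nat \<Rightarrow> int) set" where
  "MV_assignments C = {..<num_creases C} \<rightarrow>\<^sub>E {-1, 1}"

text \<open>
  Folding every crease reverses the direction in which successive faces turn about the vertex, so
  crease \<open>c\<close> lands on the ray at angle \<open>fold_pos C c\<close>, and face \<open>i\<close> on the sector between
  \<open>fold_pos C i\<close> and \<open>fold_pos C (Suc i)\<close>. If the pattern closes up and the angles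
  add up to \<open>2 * pi\<close>, all these positions lie in an interval of length at most \<open>pi\<close>, so they
  may be compared as real numbers rather than modulo \<open>2 * pi\<close>.
\<close>

definition fold_pos :: "vertex_cp \<Rightarrow> nat \<Rightarrow> real" where
  "fold_pos C c = (\<Sum>j<c. (- 1) ^ j * face_angle C j)"

definition closes_up :: "vertex_cp \<Rightarrow> bool" where
  "closes_up C \<longleftrightarrow> even (num_creases C) \<and> fold_pos C (num_creases C) = 0"

definition strictly_between :: "'a::linorder \<Rightarrow> 'a \<Rightarrow> 'a \<Rightarrow> bool" where
  "strictly_between x a b \<longleftrightarrow> min a b < x \<and> x < max a b"

text \<open>
  A layer ordering \<open>h\<close> assigns to every face its height in the folded stack. After folding, the
  faces with even index keep their front side up and those with odd index are turned over. Exactly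
  one of the two faces at a crease is thus face up. At a mountain the back sides of the two faces
  meet, so the face-up one lies above the other; at a valley the front sides meet, so it lies below.
\<close>

definition realizes_MV :: "vertex_cp \<Rightarrow> (nat \<Rightarrow> int) \<Rightarrow> (nat \<Rightarrow> nat) \<Rightarrow> bool" where
  "realizes_MV C \<mu> h \<longleftrightarrow>
     (\<forall>c<num_creases C.
        let up = (if even c then c else face_before C c);
            down = (if even c then face_before C c else c)
        in (\<mu> c = 1 \<longrightarrow> h down < h up) \<and> (\<mu> c = -1 \<longrightarrow> h up < h down))"

text \<open>
  The folded paper does not pass through itself: no face crosses a crease by having the ray
  of the crease in its interior while lying between the two layers joined there; and two creases
  on the same ray, both joining layers on the same side of it, do not interleave. With positive
  angles, the two faces at crease \<open>c\<close> both lie on the increasing side of its ray if \<open>c\<close> is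
  even and on the decreasing side if \<open>c\<close> is odd, so ``the same side'' means equal parity.
\<close>

definition no_face_crossing :: "vertex_cp \<Rightarrow> (nat \<Rightarrow> nat) \<Rightarrow> bool" where
  "no_face_crossing C h \<longleftrightarrow>
     (\<forall>c<num_creases C. \<forall>f<num_creases C.
        strictly_between (fold_pos C c) (fold_pos C f) (fold_pos C (Suc f)) \<longrightarrow>
        \<not> strictly_between (h f) (h (face_before C c)) (h c))"

definition no_crease_crossing :: "vertex_cp \<Rightarrow> (nat \<Rightarrow> nat) \<Rightarrow> bool" where
  "no_crease_crossing C h \<longleftrightarrow>
     (\<forall>c<num_creases C. \<forall>d<num_creases C.
        c \<noteq> d \<and> fold_pos C c = fold_pos C d \<and> (even c \<longleftrightarrow> even d) \<longrightarrow>
        (strictly_between (h (face_before C d)) (h (face_before C c)) (h c) \<longleftrightarrow>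
         strictly_between (h d) (h (face_before C c)) (h c)))"

definition flat_folding :: "vertex_cp \<Rightarrow> (nat \<Rightarrow> int) \<Rightarrow> (nat \<Rightarrow> nat) \<Rightarrow> bool" where
  "flat_folding C \<mu> h \<longleftrightarrow>
     closes_up C \<and> inj_on h {..<num_creases C} \<and> realizes_MV C \<mu> h \<and>
     no_face_crossing C h \<and> no_crease_crossing C h"

definition valid_MV :: "vertex_cp \<Rightarrow> (nat \<Rightarrow> int) \<Rightarrow> bool" where
  "valid_MV C \<mu> \<longleftrightarrow> \<mu> \<in> MV_assignments C \<and> (\<exists>h. flat_folding C \<mu> h)"

definition flip_face :: "vertex_cp \<Rightarrow> nat \<Rightarrow> (nat \<Rightarrow> int) \<Rightarrow> nat \<Rightarrow> int" where
  "flip_face C i \<mu> = (\<lambda>c. if c = i \<or> c = next_crease C i then - \<mu> c else \<mu> c)"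

text \<open>
  Undirected graphs; an edge is the two-element set of its endpoints, so two faces whose flips
  connect the same pair of vertices would give one edge.
\<close>

record 'v ugraph =
  vertices :: "'v set"
  edges :: "'v set set"

definition OFG :: "vertex_cp \<Rightarrow> (nat \<Rightarrow> int) ugraph" where
  "OFG C = \<lparr>vertices = {\<mu>. valid_MV C \<mu>},
            edges = {{\<mu>, \<nu>} | \<mu> \<nu>. valid_MV C \<mu> \<and> valid_MV C \<nu> \<and>
                       (\<exists>i<num_creases C. \<nu> = flip_face C i \<mu>)}\<rparr>"

end

theory Submission
  imports Defs
begin

text \<open>
  When all angles are equal, every face folds onto the same sector and the creases fold alternately
  onto its two sides. Recording each face by its height turns a flat folding into a closed curve that
  meets a line once per face: the even creases are pairwise disjoint arcs on one side of the line,
  the odd creases pairwise disjoint arcs on the other, which is a closed meander. The sign of a crease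
  says whether its arc turns left or right.

  The count rests on the fact that an assignment is valid iff its sum is \<open>2\<close> or \<open>-2\<close>
  (\<open>valid_MV_A_iff\<close>). Necessity holds because a simple closed curve turns exactly once; each arc
  is a half turn. Lemma \<open>discrete_umlaufsatz\<close> proves this with Hopf's secant argument, in which
  the direction of a secant is merely the sign of a difference of heights. Sufficiency is by induction
  (\<open>exists_meander\<close>): as long as there are more than two creases, a mountain is next to a valley;
  cancel the two, fold the rest, and then replace one face by a zigzag of three neighbouring layers
  (\<open>split_face_meander\<close>).

  For the edges, fix a face between the creases \<open>i\<close> and \<open>j\<close>. A flip changes the sign of crease
  \<open>i\<close>, so every edge that flips this face has exactly one end with a mountain at \<open>i\<close>, and the
  edges correspond to the pairs of a face and such an end (\<open>inj_flip_edge\<close>). If \<open>j\<close> is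
  a valley, the flip keeps the sum and the other \<open>2 n - 2\<close> creases contain \<open>n\<close> or \<open>n - 2\<close>
  mountains. If \<open>j\<close> is a mountain, the sum must drop from \<open>2\<close> to \<open>-2\<close>, and the
  others contain \<open>n - 1\<close>. With \<open>2 n\<close> faces this gives
  \<open>2 n (2 C(2 n - 2, n - 2) + C(2 n - 2, n - 1))\<close> edges, where \<open>C\<close> is the binomial
  coefficient.
\<close>

section \<open>Flat foldings with equal angles as closed meanders\<close>

text \<open>
  Crease \<open>c\<close> is an arc from the height of face \<open>(c + N - 1) mod N\<close> to that of face
  \<open>c\<close>; its parity is the side of the line on which it lies, so only arcs of equal parity can
  interleave.
\<close>

definition noncrossing :: "nat \<Rightarrow> (nat \<Rightarrow> 'a::linorder) \<Rightarrow> bool" where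
  "noncrossing N h \<longleftrightarrow>
     (\<forall>c<N. \<forall>d<N. c \<noteq> d \<and> (even c \<longleftrightarrow> even d) \<longrightarrow>
        (strictly_between (h ((d + N - 1) mod N)) (h ((c + N - 1) mod N)) (h c) \<longleftrightarrow>
         strictly_between (h d) (h ((c + N - 1) mod N)) (h c)))"

text \<open>
  A mountain puts the even one of its two faces on top, so an even crease is a mountain iff its arc is
  traversed upwards and an odd one iff it is traversed downwards.
\<close>

definition has_signs :: "nat \<Rightarrow> (nat \<Rightarrow> int) \<Rightarrow> (nat \<Rightarrow> 'a::linorder) \<Rightarrow> bool" where
  "has_signs N \<mu> h \<longleftrightarrow>
     (\<forall>c<N. \<mu> c = (if h ((c + N - 1) mod N) < h c \<longleftrightarrow> even c then 1 else - 1))"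

lemma strictly_between_iff:
  "strictly_between x a b \<longleftrightarrow> a < x \<and> x < b \<or> b < x \<and> x < a"
  unfolding strictly_between_def min_def max_def by auto

lemma num_creases_A [simp]: "num_creases (A_cp m) = m"
  by (simp add: A_cp_def)

lemma fold_pos_A:
  "fold_pos (A_cp m) c = (if even c then 0 else 2 * pi / real m)"
  by (induction c) (auto simp: fold_pos_def A_cp_def)

lemma pred_mod_eq:
  fixes N d :: nat
  assumes "d < N"
  shows "(d + N - 1) mod N = (if d = 0 then N - 1 else d - 1)"
  using assms by (cases d) auto

lemma pred_mod_neq:
  fixes N c :: nat
  assumes "c < N" "1 < N"
  shows "(c + N - 1) mod N \<noteq> c"
  using assms by (cases c) (auto simp: pred_mod_eq)

lemma even_pred_mod:
  fixes N d :: nat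
  assumes "even N" "d < N"
  shows "even ((d + N - 1) mod N) \<longleftrightarrow> odd d"
  using assms unfolding pred_mod_eq[OF assms(2)] by (cases d) auto

lemma pred_mod_inj:
  fixes N c d :: nat
  assumes "c < N" "d < N" "(c + N - 1) mod N = (d + N - 1) mod N"
  shows "c = d"
  using assms unfolding pred_mod_eq[OF assms(1)] pred_mod_eq[OF assms(2)]
  by (simp split: if_splits)

lemma MV_val:
  assumes "\<mu> \<in> MV_assignments (A_cp N)" "c < N"
  shows "\<mu> c = 1 \<or> \<mu> c = - 1"
  using assms by (auto simp: MV_assignments_def PiE_def Pi_def)

text \<open>
  All faces fold onto one sector whose boundary rays carry all the creases. No crease ray is thus
  interior to a face, and two creases share a ray exactly if they have equal parity.
\<close>

lemma flat_folding_A_iff: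
  assumes n: "n > 0" and \<mu>: "\<mu> \<in> MV_assignments (A_cp (2 * n))"
  shows "flat_folding (A_cp (2 * n)) \<mu> h \<longleftrightarrow>
    inj_on h {..<2 * n} \<and> has_signs (2 * n) \<mu> h \<and> noncrossing (2 * n) h"
proof -
  let ?C = "A_cp (2 * n)"
  have "closes_up ?C"
    by (simp add: closes_up_def fold_pos_A)
  moreover have "no_face_crossing ?C h"
    using n by (auto simp: no_face_crossing_def fold_pos_A strictly_between_def)
  moreover have "no_crease_crossing ?C h \<longleftrightarrow> noncrossing (2 * n) h"
    using n by (auto simp: no_crease_crossing_def noncrossing_def fold_pos_A face_before_def)
  moreover have "realizes_MV ?C \<mu> h \<longleftrightarrow> has_signs (2 * n) \<mu> h" if inj: "inj_on h {..<2 * n}"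
  proof -
    note val = MV_val[OF \<mu>]
    have neq: "h ((c + 2 * n - 1) mod (2 * n)) \<noteq> h c" if "c < 2 * n" for c
      using inj_onD[OF inj, of "(c + 2 * n - 1) mod (2 * n)" c] pred_mod_neq[of c "2 * n"] n that
      by auto
    show ?thesis
      unfolding realizes_MV_def has_signs_def Let_def face_before_def num_creases_A
    proof (intro all_cong)
      fix c assume c: "c < 2 * n"
      let ?p = "(c + 2 * n - 1) mod (2 * n)"
      show "((\<mu> c = 1 \<longrightarrow> h (if even c then ?p else c) < h (if even c then c else ?p)) \<and>
             (\<mu> c = - 1 \<longrightarrow> h (if even c then c else ?p) < h (if even c then ?p else c))) =
            (\<mu> c = (if h ?p < h c \<longleftrightarrow> even c then 1 else - 1))"
        using val[OF c] neq[OF c] by (cases "even c") auto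
    qed
  qed
  ultimately show ?thesis
    unfolding flat_folding_def by auto
qed

section \<open>The turning number\<close>

text \<open>
  As a function of \<open>c\<close>, the difference \<open>sgn (c - a) - sgn (c - b)\<close> depends only on
  whether \<open>c\<close> lies between \<open>a\<close> and \<open>b\<close>, so it agrees at the two ends of an arc that
  does not interleave with the arc from \<open>a\<close> to \<open>b\<close>.
\<close>

lemma secant_sgn_eq:
  fixes a b c d :: int
  assumes "strictly_between c a b \<longleftrightarrow> strictly_between d a b"
    and "c \<noteq> a" "c \<noteq> b" "d \<noteq> a" "d \<noteq> b"
  shows "sgn (c - a) - sgn (d - a) - sgn (c - b) + sgn (d - b) = 0"
proof -
  have sgn_diff: "sgn (x - y) = (if y < x then 1 else - 1)" if "x \<noteq> y" for x y :: int
    using that by simp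
  show ?thesis
    using assms unfolding sgn_diff[OF assms(2)] sgn_diff[OF assms(3)] sgn_diff[OF assms(4)]
      sgn_diff[OF assms(5)] strictly_between_iff
    by (smt (verit))
qed

text \<open>
  Hopf's proof that the tangent of a simple closed curve turns once, for a curve that crosses a line at
  the heights \<open>g 0, g 1, \<dots>, g N = g 0\<close> and runs between consecutive crossings along arcs
  on alternating sides. The secant from crossing \<open>i\<close> to crossing \<open>j\<close> points up or
  down, and when one end moves along an arc, the secant swings through the side of that arc, or the
  opposite side for the other end. The total swing along a lattice path of pairs \<open>i < j\<close> depends
  only on the end points of the path: over a unit square the two ways around agree, by the opposite
  sides of the arcs or, on the same side, by \<open>secant_sgn_eq\<close>. Along the diagonal the swing is
  the turning of the curve; along the legs \<open>i = 0\<close> and \<open>j = N\<close> it is known because the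
  curve starts at its lowest point.
\<close>

lemma discrete_umlaufsatz:
  fixes g :: "nat \<Rightarrow> int"
  assumes N: "even N" "N \<ge> 2"
    and closed: "g N = g 0"
    and lowest: "\<And>i. 0 < i \<Longrightarrow> i < N \<Longrightarrow> g 0 < g i"
    and inj: "inj_on g {..<N}"
    and disjoint: "\<And>i j. i + 2 \<le> j \<Longrightarrow> j < N \<Longrightarrow> even (i + j) \<Longrightarrow>
      strictly_between (g j) (g i) (g (Suc i)) \<longleftrightarrow>
      strictly_between (g (Suc j)) (g i) (g (Suc i))"
  shows "(\<Sum>i<N. (- 1) ^ Suc i * sgn (g (Suc i) - g i)) = - 2"
proof -
  define D where "D i j = sgn (g j - g i)" for i j
  define s :: "nat \<Rightarrow> int" where "s i = (- 1) ^ i" for i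
  define t where "t i = s (Suc i) * D i (Suc i)" for i
  define M where "M i j = D i j - D i (Suc j) - D (Suc i) j + D (Suc i) (Suc j)" for i j
  \<comment> \<open>Twice the swing, in half turns, of the secant from crossing \<open>i\<close> as its other end runs to the end of the curve.\<close>
  define H where "H i = (\<Sum>j = Suc i..<N. s (Suc j) * (D i j - D i (Suc j)))" for i
  have s_Suc: "s (Suc i) = - s i" for i by (simp add: s_def)
  have D0: "D 0 j = 1" if "0 < j" "j < N" for j
    using lowest[OF that] by (simp add: D_def)
  \<comment> \<open>The secant from \<open>0\<close> to \<open>N\<close> is degenerate and has sign 0. This does no harm: the only
    square at that corner joins arcs on opposite sides.\<close>
  have DN: "D i N = (if i = 0 then 0 else - 1)" if "i < N" for i
    using lowest[of i] that by (simp add: D_def closed)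
  have M0: "(s (Suc i) + s (Suc j)) * M i j = 0" if ij: "i + 2 \<le> j" "j < N" for i j
  proof (cases "even (i + j)")
    case False
    then have "s (Suc i) + s (Suc j) = 0"
      by (cases "even i") (auto simp: s_def)
    then show ?thesis by simp
  next
    case True
    have ne: "g a \<noteq> g b" if "a < N" "b < N" "a \<noteq> b" for a b
      using inj that by (auto simp: inj_on_def)
    have ne': "g (Suc j) \<noteq> g i" "g (Suc j) \<noteq> g (Suc i)"
    proof -
      have "g (Suc j) \<noteq> g a" if a: "a = i \<or> a = Suc i" for a
      proof (cases "Suc j = N")
        case False
        then show ?thesis using ne[of "Suc j" a] a ij by auto
      next
        case sj: True
        have "i \<noteq> 0"
        proof
          assume "i = 0"
          then show False using True sj N by (metis add_0 even_Suc)
        qed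
        then show ?thesis using ne[of 0 a] a ij sj closed by auto
      qed
      then show "g (Suc j) \<noteq> g i" "g (Suc j) \<noteq> g (Suc i)" by auto
    qed
    have "M i j = 0"
      unfolding M_def D_def
      by (rule secant_sgn_eq[OF disjoint[OF ij True]]) (use ne ne' ij in auto)
    then show ?thesis by simp
  qed
  \<comment> \<open>Rows \<open>i\<close> and \<open>i + 1\<close> differ by the squares between them, which telescope to their ends.\<close>
  have step: "H (Suc i) - H i = t i + t (Suc i) + (if i = 0 then 1 else 0)"
    if i: "Suc i < N" for i
  proof -
    let ?R = "\<Sum>j = Suc (Suc i)..<N. s (Suc j) * (D i j - D i (Suc j))"
    have "H i = s (Suc (Suc i)) * (D i (Suc i) - D i (Suc (Suc i))) + ?R"
      unfolding H_def using i by (simp add: sum.atLeast_Suc_lessThan)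
    moreover have "H (Suc i) - ?R = (\<Sum>j = Suc (Suc i)..<N. - (s (Suc j) * M i j))"
      unfolding H_def sum_subtractf[symmetric]
      by (rule sum.cong) (simp_all add: M_def algebra_simps)
    ultimately have "H (Suc i) - H i = s (Suc i) * (D i (Suc i) - D i (Suc (Suc i))) -
        (\<Sum>j = Suc (Suc i)..<N. s (Suc j) * M i j)"
      by (simp add: s_Suc sum_negf)
    also have "(\<Sum>j = Suc (Suc i)..<N. s (Suc j) * M i j) =
        (\<Sum>j = Suc (Suc i)..<N. s (Suc i) * ((D i (Suc j) - D (Suc i) (Suc j)) - (D i j - D (Suc i) j)))"
    proof (rule sum.cong[OF refl])
      fix j assume j: "j \<in> {Suc (Suc i)..<N}"
      have "s (Suc j) * M i j = - s (Suc i) * M i j"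
        using M0[of i j] j by (simp add: algebra_simps)
      then show "s (Suc j) * M i j =
          s (Suc i) * ((D i (Suc j) - D (Suc i) (Suc j)) - (D i j - D (Suc i) j))"
        by (simp add: M_def algebra_simps)
    qed
    also have "\<dots> = s (Suc i) * ((D i N - D (Suc i) N) -
        (D i (Suc (Suc i)) - D (Suc i) (Suc (Suc i))))"
      using i sum_Suc_diff'[of "Suc (Suc i)" N "\<lambda>j. D i j - D (Suc i) j"]
      by (simp add: sum_distrib_left[symmetric])
    finally have "H (Suc i) - H i =
        t i + t (Suc i) - s (Suc i) * (D i N - D (Suc i) N)"
      by (simp add: t_def s_Suc algebra_simps)
    then show ?thesis using DN[of i] DN[of "Suc i"] i by (auto simp: s_def)
  qed
  obtain K where K: "N = Suc (Suc K)" using N by (metis add_2_eq_Suc le_Suc_ex)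
  have "H 0 = 1"
  proof -
    have "H 0 = (\<Sum>j = 1..<Suc K. s (Suc j) * (D 0 j - D 0 (Suc j))) +
        s N * (D 0 (Suc K) - D 0 N)"
      by (simp add: H_def K)
    also have "(\<Sum>j = 1..<Suc K. s (Suc j) * (D 0 j - D 0 (Suc j))) = 0"
      by (rule sum.neutral) (auto simp: D0 K)
    finally show ?thesis
      using D0[of "Suc K"] DN[of 0] N K by (simp add: s_def)
  qed
  moreover have "H (Suc K) = 0"
    by (simp add: H_def K)
  moreover have "H (Suc K) - H 0 = (\<Sum>i<N. t i) - t (Suc K) + ((\<Sum>i<N. t i) - t 0) + 1"
  proof -
  have "H (Suc K) - H 0 = (\<Sum>i<Suc K. H (Suc i) - H i)"
    by (simp only: sum_lessThan_telescope)
  also have "\<dots> = (\<Sum>i<Suc K. t i + t (Suc i) + (if i = 0 then 1 else 0))"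
    by (rule sum.cong[OF refl], rule step) (simp add: K)
  also have "\<dots> = (\<Sum>i<N. t i) - t (Suc K) + ((\<Sum>i<N. t i) - t 0) + 1"
  proof -
    have "(\<Sum>i<N. t i) = t 0 + (\<Sum>i<Suc K. t (Suc i))"
      by (simp only: K sum.lessThan_Suc_shift)
    moreover have "(\<Sum>i<N. t i) = (\<Sum>i<Suc K. t i) + t (Suc K)"
      by (simp only: K sum.lessThan_Suc)
    moreover have "(\<Sum>i<Suc K. if i = 0 then 1 else 0) = (1 :: int)"
      by (simp only: sum.lessThan_Suc_shift) simp
    ultimately show ?thesis by (simp only: sum.distrib)
  qed
  finally show ?thesis .
  qed
  moreover have "t 0 = - 1" using D0[of 1] K by (simp add: t_def s_def)
  moreover have "t (Suc K) = - 1" using DN[of "Suc K"] K N by (simp add: t_def s_def)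
  ultimately show ?thesis
    by (simp add: t_def s_def D_def)
qed


text \<open>
  To apply \<open>discrete_umlaufsatz\<close>, the faces are renumbered from the lowest one. Starting at an
  odd face exchanges the two sides and so reverses all signs, which is why both values occur.
\<close>

lemma sum_signs_of_meander:
  fixes h :: "nat \<Rightarrow> nat"
  assumes N: "even N" "N \<ge> 2"
    and inj: "inj_on h {..<N}" and sg: "has_signs N \<mu> h" and nc: "noncrossing N h"
  shows "(\<Sum>c<N. \<mu> c) = 2 \<or> (\<Sum>c<N. \<mu> c) = - 2"
proof -
  have "finite (h ` {..<N})" "h ` {..<N} \<noteq> {}" using N by (auto simp: lessThan_empty_iff)
  then have "Min (h ` {..<N}) \<in> h ` {..<N}" by (rule Min_in)
  then obtain m where m: "m < N" "h m = Min (h ` {..<N})" by auto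
  have hm: "h m \<le> h f" if "f < N" for f
    using that m(2) by simp
  define r where "r i = (m + i) mod N" for i
  define g where "g i = int (h (r i))" for i
  have r_lt: "r i < N" for i using N by (simp add: r_def)
  have r_pred: "(r (Suc i) + N - 1) mod N = r i" for i
  proof -
    have "(r (Suc i) + N - 1) mod N = (r (Suc i) + (N - 1)) mod N"
      using N by simp
    also have "\<dots> = (m + Suc i + (N - 1)) mod N"
      unfolding r_def by (rule mod_add_left_eq)
    also have "m + Suc i + (N - 1) = m + i + N" using N by simp
    finally show ?thesis by (simp add: r_def)
  qed
  have r_even: "even (r i) \<longleftrightarrow> even (m + i)" for i
    unfolding r_def using N(1) by (simp add: dvd_mod_iff)
  have r_N: "r N = r 0"
    by (simp add: r_def)
  have r_inj: "inj_on r {..<N}"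
  proof (rule inj_onI)
    fix i j assume ij: "i \<in> {..<N}" "j \<in> {..<N}" "r i = r j"
    have "r k = (if m + k < N then m + k else m + k - N)" if "k < N" for k
      using that m(1) by (simp add: r_def mod_if)
    then show "i = j" using ij m(1) by (auto split: if_splits)
  qed
  have r_bij: "bij_betw r {..<N} {..<N}"
    using endo_inj_surj[of "{..<N}" r] r_inj r_lt by (auto simp: bij_betw_def)
  have sgn_eq: "\<mu> (r (Suc i)) = (- 1) ^ m * ((- 1) ^ Suc i * sgn (g (Suc i) - g i))"
    if "i < N" for i
  proof -
    have "r i \<noteq> r (Suc i)"
      using pred_mod_neq[of "r (Suc i)" N] r_lt N r_pred[of i] by simp
    then have ne: "h (r i) \<noteq> h (r (Suc i))"
      using inj r_lt by (auto simp: inj_on_def)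
    have "\<mu> (r (Suc i)) = (if h (r i) < h (r (Suc i)) \<longleftrightarrow> even (m + Suc i) then 1 else - 1)"
      using sg r_lt[of "Suc i"] r_even[of "Suc i"] r_pred[of i] unfolding has_signs_def by simp
    also have "\<dots> = (- 1) ^ (m + Suc i) * sgn (g (Suc i) - g i)"
      using ne unfolding g_def by (cases "even (m + Suc i)") auto
    finally show ?thesis by (simp add: power_add)
  qed
  have turning: "(\<Sum>i<N. (- 1) ^ Suc i * sgn (g (Suc i) - g i)) = - 2"
  proof (rule discrete_umlaufsatz[OF N])
    show "g N = g 0" by (simp add: g_def r_N)
    show "inj_on g {..<N}"
      using r_inj r_lt inj unfolding g_def inj_on_def by simp
    show "g 0 < g i" if i: "0 < i" "i < N" for i
    proof -
      have "r 0 = m" using m by (simp add: r_def)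
      moreover have "r i \<noteq> r 0"
        using inj_onD[OF r_inj, of i 0] i by auto
      ultimately have "h (r i) \<noteq> h m" using inj r_lt[of i] m(1) by (auto simp: inj_on_def)
      then show ?thesis using hm[OF r_lt[of i]] \<open>r 0 = m\<close> by (simp add: g_def)
    qed
    show "strictly_between (g j) (g i) (g (Suc i)) \<longleftrightarrow>
        strictly_between (g (Suc j)) (g i) (g (Suc i))"
      if ij: "i + 2 \<le> j" "j < N" "even (i + j)" for i j
    proof -
      have "r (Suc j) \<noteq> r (Suc i)"
      proof (cases "Suc j = N")
        case True
        then have "r (Suc j) = r 0" using r_N by simp
        then show ?thesis using inj_onD[OF r_inj, of 0 "Suc i"] ij by auto
      next
        case False
        then show ?thesis using inj_onD[OF r_inj, of "Suc i" "Suc j"] ij by auto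
      qed
      moreover have "even (r (Suc i)) \<longleftrightarrow> even (r (Suc j))"
        using ij(3) by (auto simp: r_even)
      ultimately have "strictly_between (h (r j)) (h (r i)) (h (r (Suc i))) \<longleftrightarrow>
          strictly_between (h (r (Suc j))) (h (r i)) (h (r (Suc i)))"
        using nc r_lt[of "Suc i"] r_lt[of "Suc j"] r_pred[of i] r_pred[of j]
        unfolding noncrossing_def by metis
      then show ?thesis by (simp add: g_def strictly_between_iff)
    qed
  qed
  have "(\<Sum>c<N. \<mu> c) = (\<Sum>i<N. \<mu> (r i))"
    using sum.reindex_bij_betw[OF r_bij, of \<mu>] by simp
  also have "\<dots> = (\<Sum>i<N. \<mu> (r (Suc i)))"
    using sum.lessThan_Suc_shift[of "\<lambda>i. \<mu> (r i)" N] sum.lessThan_Suc[of "\<lambda>i. \<mu> (r i)" N]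
    by (simp add: r_N)
  also have "\<dots> = (- 1) ^ m * (\<Sum>i<N. (- 1) ^ Suc i * sgn (g (Suc i) - g i))"
    unfolding sum_distrib_left by (rule sum.cong) (simp_all only: sgn_eq lessThan_iff)
  finally show ?thesis
    unfolding turning by (cases "even m") auto
qed

section \<open>Cancelling a mountain next to a valley\<close>

text \<open>
  The renumbering of faces when the creases \<open>c\<close> and \<open>c + 1\<close> are deleted and the three
  faces at them become one. On the other creases the same map is the renumbering of creases.
\<close>

definition merge_faces :: "nat \<Rightarrow> nat \<Rightarrow> nat" where
  "merge_faces c f = (if f < c then f else if f \<le> Suc c then c - 1 else f - 2)"

text \<open>
  The surviving creases are shifted by an even number, so they keep their side of the line, and they
  still join the images of the faces that they joined before. Taking \<open>c\<close> positive keeps the three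
  merged faces from running over the cyclic seam.
\<close>

lemma merge_faces_crease:
  assumes c: "0 < c" "Suc c < N" and d: "d < N" "d \<noteq> c" "d \<noteq> Suc c"
  shows "merge_faces c d = (if d < c then d else d - 2)"
    and "merge_faces c d < N - 2"
    and "even (merge_faces c d) \<longleftrightarrow> even d"
    and "merge_faces c ((d + N - 1) mod N) = (merge_faces c d + (N - 2) - 1) mod (N - 2)"
proof -
  show eq: "merge_faces c d = (if d < c then d else d - 2)"
    using c d by (auto simp: merge_faces_def)
  show lt: "merge_faces c d < N - 2"
    using c d unfolding eq by auto
  show "even (merge_faces c d) \<longleftrightarrow> even d"
    using c d unfolding eq by (auto simp: not_less)
  show "merge_faces c ((d + N - 1) mod N) = (merge_faces c d + (N - 2) - 1) mod (N - 2)"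
    unfolding pred_mod_eq[OF d(1)] pred_mod_eq[OF lt] unfolding eq
  proof (cases "d < c")
    case True
    then show "merge_faces c (if d = 0 then N - 1 else d - 1) =
        (if (if d < c then d else d - 2) = 0 then N - 2 - 1 else (if d < c then d else d - 2) - 1)"
      using c by (cases "d = 0") (auto simp: merge_faces_def)
  next
    case False
    then have "d > Suc c" using d by simp
    then show "merge_faces c (if d = 0 then N - 1 else d - 1) =
        (if (if d < c then d else d - 2) = 0 then N - 2 - 1 else (if d < c then d else d - 2) - 1)"
      using c by (auto simp: merge_faces_def)
  qed
qed

text \<open>
  Splitting a face of a meander into a zigzag. The new arcs \<open>c\<close> and \<open>c + 1\<close> run in the same
  vertical direction on opposite sides, hence have opposite signs, and choosing the direction realizes
  either sign at \<open>c\<close>. The three new faces occupy consecutive heights in place of the old one: the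
  new arcs are too short to interleave with anything, and every other arc sees the same order as before.
\<close>

lemma split_face_meander:
  fixes h :: "nat \<Rightarrow> nat"
  assumes N: "even N" and c: "0 < c" "Suc c < N"
    and opp: "\<mu> (Suc c) = - \<mu> c" and val: "\<mu> c = 1 \<or> \<mu> c = - 1"
    and inj: "inj_on h {..<N - 2}"
    and sg: "has_signs (N - 2) (\<lambda>d. if d < c then \<mu> d else \<mu> (d + 2)) h"
    and nc: "noncrossing (N - 2) h"
  shows "\<exists>h' :: nat \<Rightarrow> nat. inj_on h' {..<N} \<and> has_signs N \<mu> h' \<and> noncrossing N h'"
proof -
  let ?p = "\<lambda>N d. (d + N - 1) mod N"
  define up where "up \<longleftrightarrow> (\<mu> c = 1 \<longleftrightarrow> even c)"
  \<comment> \<open>Each old height is blown up to three; the middle face of the zigzag takes the middle one.\<close>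
  define off where "off f = (if f = c then 1 else if f = c - 1 \<and> \<not> up \<or> f = Suc c \<and> up then 2
      else 0 :: nat)" for f
  define h' where "h' f = 3 * h (merge_faces c f) + off f" for f
  have off: "off f < 3" for f by (simp add: off_def)
  have merge_lt: "merge_faces c f < N - 2" if "f < N" for f
    using that c by (auto simp: merge_faces_def)
  have less_iff: "h' f < h' f' \<longleftrightarrow> h (merge_faces c f) < h (merge_faces c f')"
    if "f < N" "f' < N" "merge_faces c f \<noteq> merge_faces c f'" for f f'
  proof -
    have "h (merge_faces c f) \<noteq> h (merge_faces c f')"
      using inj merge_lt that by (auto simp: inj_on_def)
    then show ?thesis using off[of f] off[of f'] unfolding h'_def by linarith
  qed
  have merged: "merge_faces c (c - 1) = c - 1" "merge_faces c c = c - 1"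
    "merge_faces c (Suc c) = c - 1"
    using c by (auto simp: merge_faces_def)
  have merge_eqD: "f = f' \<or> f \<in> {c - 1, c, Suc c} \<and> f' \<in> {c - 1, c, Suc c}"
    if "merge_faces c f = merge_faces c f'" for f f'
    using that c by (auto simp: merge_faces_def split: if_splits)
  have inj': "inj_on h' {..<N}"
  proof (rule inj_onI)
    fix f f' assume ff: "f \<in> {..<N}" "f' \<in> {..<N}" "h' f = h' f'"
    then have "h (merge_faces c f) = h (merge_faces c f')"
      using off[of f] off[of f'] unfolding h'_def by linarith
    then have eq: "merge_faces c f = merge_faces c f'"
      using inj merge_lt ff by (auto simp: inj_on_def)
    then have "off f = off f'" using ff(3) by (simp add: h'_def)
    moreover have "off (c - 1) = (if up then 0 else 2)" "off c = 1"
        "off (Suc c) = (if up then 2 else 0)"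
      using c by (auto simp: off_def)
    ultimately show "f = f'" using merge_eqD[OF eq] by (elim disjE conjE insertE) (auto split: if_splits)
  qed
  have h'_local: "h' (c - 1) = (if up then h' c - 1 else h' c + 1)"
    "h' (Suc c) = (if up then h' c + 1 else h' c - 1)" "h' c > 0"
    using c by (auto simp: h'_def merged[simplified] off_def)
  have pc: "?p N c = c - 1" "?p N (Suc c) = c"
    using c pred_mod_eq[of c N] pred_mod_eq[of "Suc c" N] by auto
  have p_lt: "?p N d < N" if "d < N" for d using that by simp
  have other: "merge_faces c d = (if d < c then d else d - 2)" "merge_faces c d < N - 2"
      "even (merge_faces c d) \<longleftrightarrow> even d"
      "merge_faces c (?p N d) = ?p (N - 2) (merge_faces c d)"
      "merge_faces c (?p N d) \<noteq> merge_faces c d"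
    if d: "d < N" "d \<noteq> c" "d \<noteq> Suc c" for d
  proof -
    note m = merge_faces_crease[OF c d]
    show "merge_faces c d = (if d < c then d else d - 2)" "merge_faces c d < N - 2"
      "even (merge_faces c d) \<longleftrightarrow> even d"
      "merge_faces c (?p N d) = ?p (N - 2) (merge_faces c d)"
      by (fact m)+
    have "1 < N - 2 \<or> N - 2 = 0" using N by presburger
    then show "merge_faces c (?p N d) \<noteq> merge_faces c d"
      using pred_mod_neq[OF m(2)] m(2) unfolding m(4) by auto
  qed
  have "has_signs N \<mu> h'"
    unfolding has_signs_def
  proof (intro allI impI)
    fix d assume d: "d < N"
    consider "d = c" | "d = Suc c" | "d \<noteq> c" "d \<noteq> Suc c" by blast
    then show "\<mu> d = (if h' (?p N d) < h' d \<longleftrightarrow> even d then 1 else - 1)"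
    proof cases
      case 1
      show ?thesis unfolding 1 pc using val h'_local by (auto simp: up_def)
    next
      case 2
      show ?thesis unfolding 2 pc using val opp h'_local by (auto simp: up_def)
    next
      case 3
      note o = other[OF d 3]
      have "h' (?p N d) < h' d \<longleftrightarrow> h (?p (N - 2) (merge_faces c d)) < h (merge_faces c d)"
        using less_iff[OF p_lt[OF d] d o(5)] by (simp only: o(4))
      moreover have "(if merge_faces c d < c then \<mu> (merge_faces c d) else \<mu> (merge_faces c d + 2)) = \<mu> d"
      proof (cases "d < c")
        case True
        then show ?thesis by (simp add: o(1))
      next
        case False
        then obtain k where "d = Suc (Suc k)" "\<not> k < c" using 3 that[of "d - 2"] c by auto
        then show ?thesis unfolding o(1) using False by simp
      qed
      ultimately show ?thesis
        using sg o(2,3) unfolding has_signs_def by metis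
    qed
  qed
  moreover have "noncrossing N h'"
    unfolding noncrossing_def
  proof (intro allI impI, elim conjE)
    fix d e assume d: "d < N" and e: "e < N" and de: "d \<noteq> e" and par: "even d \<longleftrightarrow> even e"
    have ne: "h' x \<noteq> h' y" if "x < N" "y < N" "x \<noteq> y" for x y
      using inj' that by (auto simp: inj_on_def)
    have "?p N e \<noteq> ?p N d" using pred_mod_inj[OF e d] de by auto
    moreover have "?p N e \<noteq> d" "e \<noteq> ?p N d"
      using even_pred_mod[OF N d] even_pred_mod[OF N e] par by auto
    ultimately have ne4: "h' (?p N e) \<noteq> h' (?p N d)" "h' (?p N e) \<noteq> h' d"
        "h' e \<noteq> h' (?p N d)" "h' e \<noteq> h' d"
      using ne d e de p_lt by (metis (no_types))+
    have adjacent: "h' (?p N x) = Suc (h' x) \<or> h' x = Suc (h' (?p N x))"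
      if "x = c \<or> x = Suc c" for x
      using that
    proof
      assume x: "x = c"
      show ?thesis unfolding x pc using h'_local by (cases up) auto
    next
      assume x: "x = Suc c"
      show ?thesis unfolding x pc using h'_local by (cases up) auto
    qed
    show "strictly_between (h' (?p N e)) (h' (?p N d)) (h' d) \<longleftrightarrow>
          strictly_between (h' e) (h' (?p N d)) (h' d)"
    proof (cases "d = c \<or> d = Suc c \<or> e = c \<or> e = Suc c")
      case True
      have consecutive: "(u < x \<longleftrightarrow> v < x) \<and> (x < u \<longleftrightarrow> x < v)"
        if "u = Suc v \<or> v = Suc u" "u \<noteq> x" "v \<noteq> x" for u v x :: nat
        using that by auto
      from True consider "d = c \<or> d = Suc c" | "e = c \<or> e = Suc c" by blast
      then show ?thesis
      proof cases
        case 1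
        have "\<not> strictly_between x (h' (?p N d)) (h' d)" for x
          using adjacent[OF 1] unfolding strictly_between_iff by auto
        then show ?thesis by simp
      next
        case 2
        show ?thesis
          using consecutive[OF adjacent[OF 2] ne4(1,3)] consecutive[OF adjacent[OF 2] ne4(2,4)]
          unfolding strictly_between_iff by simp
      qed
    next
      case False
      then have d': "d \<noteq> c" "d \<noteq> Suc c" and e': "e \<noteq> c" "e \<noteq> Suc c" by auto
      note od = other[OF d d'] and oe = other[OF e e']
      have N2: "even (N - 2)" using N by simp
      have mne: "merge_faces c d \<noteq> merge_faces c e"
      proof
        assume "merge_faces c d = merge_faces c e"
        then have "d = c - 1" "e = c - 1"
          using merge_eqD[of d e] de d' e' by blast+
        then show False using de by simp
      qed
      have par': "even (merge_faces c d) \<longleftrightarrow> even (merge_faces c e)"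
        using od(3) oe(3) par by simp
      have between: "strictly_between (h' x) (h' (?p N d)) (h' d) \<longleftrightarrow>
          strictly_between (h (merge_faces c x)) (h (merge_faces c (?p N d))) (h (merge_faces c d))"
        if "x < N" "merge_faces c x \<noteq> merge_faces c d" "merge_faces c x \<noteq> merge_faces c (?p N d)" for x
        unfolding strictly_between_iff
        using less_iff[OF that(1) d that(2)] less_iff[OF d that(1) that(2)[symmetric]]
          less_iff[OF that(1) p_lt[OF d] that(3)] less_iff[OF p_lt[OF d] that(1) that(3)[symmetric]]
        by simp
      have "merge_faces c (?p N e) \<noteq> merge_faces c (?p N d)"
        unfolding od(4) oe(4) using pred_mod_inj[OF oe(2) od(2)] mne by auto
      moreover have "merge_faces c (?p N e) \<noteq> merge_faces c d" "merge_faces c e \<noteq> merge_faces c (?p N d)"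
        unfolding od(4) oe(4)
        using even_pred_mod[OF N2 od(2)] even_pred_mod[OF N2 oe(2)] par' by auto
      moreover have "strictly_between (h (merge_faces c (?p N e))) (h (merge_faces c (?p N d)))
            (h (merge_faces c d)) \<longleftrightarrow>
          strictly_between (h (merge_faces c e)) (h (merge_faces c (?p N d))) (h (merge_faces c d))"
        unfolding od(4) oe(4) using nc od(2) oe(2) mne par' unfolding noncrossing_def by blast
      ultimately show ?thesis
        using between[OF p_lt[OF e]] between[OF e] mne by simp
    qed
  qed
  ultimately show ?thesis using inj' by blast
qed

text \<open>
  With four creases of which only crease \<open>0\<close> has the opposite sign, the sign changes only at the
  seam or next to it, where \<open>split_face_meander\<close> does not reach. A folding is given outright.
\<close>

lemma exceptional_meander:
  assumes "\<mu> 0 = 1 \<or> \<mu> 0 = - 1" "\<And>c. 0 < c \<Longrightarrow> c < 4 \<Longrightarrow> \<mu> c = - \<mu> 0"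
  shows "\<exists>h :: nat \<Rightarrow> nat. inj_on h {..<4} \<and> has_signs 4 \<mu> h \<and> noncrossing 4 h"
proof -
  have all4: "(\<forall>c<4. P c) \<longleftrightarrow> P 0 \<and> P 1 \<and> P 2 \<and> P (3 :: nat)" for P
    by (auto simp: less_Suc_eq numeral_eq_Suc)
  have set4: "{..<4} = {0, 1, 2, 3 :: nat}" by auto
  have \<mu>: "\<mu> (Suc 0) = - \<mu> 0" "\<mu> 2 = - \<mu> 0" "\<mu> 3 = - \<mu> 0" using assms(2) by auto
  \<comment> \<open>Faces \<open>2, 3, 0, 1\<close> from bottom to top; upside down for the other sign.\<close>
  define h where "h f = (if f = 0 then 2 else if f = 1 then 3 else if f = 2 then 0 else 1 :: nat)"
    for f :: nat
  show ?thesis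
  proof (cases "\<mu> 0 = 1")
    case True
    have "inj_on h {..<4} \<and> has_signs 4 \<mu> h \<and> noncrossing 4 h"
      unfolding has_signs_def noncrossing_def all4 set4
      by (simp add: h_def \<mu> True strictly_between_iff)
    then show ?thesis by blast
  next
    case False
    then have "\<mu> 0 = - 1" using assms(1) by simp
    then have "inj_on (\<lambda>f. 3 - h f) {..<4} \<and> has_signs 4 \<mu> (\<lambda>f. 3 - h f) \<and>
        noncrossing 4 (\<lambda>f. 3 - h f)"
      unfolding has_signs_def noncrossing_def all4 set4
      by (simp add: h_def \<mu> strictly_between_iff)
    then show ?thesis by blast
  qed
qed

text \<open>
  A sign change between consecutive creases beyond crease \<open>0\<close> can be cancelled without altering
  the sum. If there is none, all creases beyond \<open>0\<close> agree, and a sum of \<open>2\<close> or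
  \<open>-2\<close> leaves, besides two creases of equal sign, only four creases with crease \<open>0\<close>
  deviating.
\<close>

lemma exists_meander:
  fixes \<mu> :: "nat \<Rightarrow> int"
  assumes "n > 0" "\<And>c. c < 2 * n \<Longrightarrow> \<mu> c = 1 \<or> \<mu> c = - 1"
    and "(\<Sum>c<2 * n. \<mu> c) = 2 \<or> (\<Sum>c<2 * n. \<mu> c) = - 2"
  shows "\<exists>h :: nat \<Rightarrow> nat. inj_on h {..<2 * n} \<and> has_signs (2 * n) \<mu> h \<and> noncrossing (2 * n) h"
  using assms
proof (induction n arbitrary: \<mu> rule: nat_induct_non_zero)
  case 1
  have all2: "(\<forall>c<2. P c) \<longleftrightarrow> P 0 \<and> P (1 :: nat)" for P
    by (auto simp: less_Suc_eq numeral_eq_Suc)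
  have set2: "{..<2} = {0, 1 :: nat}" by auto
  have eq: "\<mu> (Suc 0) = \<mu> 0" and v: "\<mu> 0 = 1 \<or> \<mu> 0 = - 1"
    using "1.prems"(1)[of 0] "1.prems"(1)[of 1] "1.prems"(2) by (auto simp: set2)
  define h where "h f = (if f = 0 \<longleftrightarrow> \<mu> 0 = 1 then 1 else 0 :: nat)" for f :: nat
  have "inj_on h {..<2} \<and> has_signs 2 \<mu> h \<and> noncrossing 2 h"
    unfolding has_signs_def noncrossing_def all2 set2
    using eq v by (auto simp: h_def)
  then show ?case by auto
next
  case (Suc n)
  note val = Suc.prems(1) and sum = Suc.prems(2)
  show ?case
  proof (cases "\<exists>c. 0 < c \<and> Suc c < 2 * Suc n \<and> \<mu> (Suc c) \<noteq> \<mu> c")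
    case True
    then obtain c where c: "0 < c" "Suc c < 2 * Suc n" "\<mu> (Suc c) \<noteq> \<mu> c" by blast
    have opp: "\<mu> (Suc c) = - \<mu> c" and vc: "\<mu> c = 1 \<or> \<mu> c = - 1"
      using val[of c] val[of "Suc c"] c by auto
    let ?\<nu> = "\<lambda>d. if d < c then \<mu> d else \<mu> (d + 2)"
    have "(\<Sum>d<2 * Suc n. \<mu> d) = (\<Sum>d<2 * n. ?\<nu> d)"
    proof -
      have split: "(\<Sum>d<c + k. f d) = (\<Sum>d<c. f d) + (\<Sum>d<k. f (c + d))" for f :: "nat \<Rightarrow> int" and k
        by (induction k) auto
      obtain k where k: "2 * n = c + k" using c le_Suc_ex[of c "2 * n"] by auto
      have "(\<Sum>d<2 * Suc n. \<mu> d) = (\<Sum>d<c. \<mu> d) + (\<Sum>d<Suc (Suc k). \<mu> (c + d))"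
        using split[of \<mu> "Suc (Suc k)"] k by simp
      also have "(\<Sum>d<Suc (Suc k). \<mu> (c + d)) = (\<Sum>d<k. \<mu> (c + d + 2))"
        using opp by (simp add: sum.lessThan_Suc_shift del: sum.lessThan_Suc)
      finally show ?thesis unfolding k split by simp
    qed
    then have "(\<Sum>d<2 * n. ?\<nu> d) = 2 \<or> (\<Sum>d<2 * n. ?\<nu> d) = - 2"
      using sum by simp
    moreover have "?\<nu> d = 1 \<or> ?\<nu> d = - 1" if "d < 2 * n" for d
      using val[of d] val[of "d + 2"] that by auto
    ultimately obtain h :: "nat \<Rightarrow> nat" where "inj_on h {..<2 * n}" "has_signs (2 * n) ?\<nu> h"
        "noncrossing (2 * n) h"
      using Suc.IH[of ?\<nu>] by blast
    then show ?thesis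
      using split_face_meander[of "2 * Suc n" c \<mu> h] c opp vc by simp
  next
    case False
    have const: "\<mu> (Suc c) = \<mu> 1" if "Suc c < 2 * Suc n" for c
      using that
    proof (induction c)
      case (Suc c)
      then show ?case using False by force
    qed simp
    have "(\<Sum>c<2 * Suc n. \<mu> c) = \<mu> 0 + (\<Sum>c<Suc (2 * n). \<mu> (Suc c))"
      using sum.lessThan_Suc_shift[of \<mu> "Suc (2 * n)"] by simp
    also have "(\<Sum>c<Suc (2 * n). \<mu> (Suc c)) = (\<Sum>c<Suc (2 * n). \<mu> 1)"
      by (rule sum.cong[OF refl], rule const) simp
    finally have "(\<Sum>c<2 * Suc n. \<mu> c) = \<mu> 0 + (2 * int n + 1) * \<mu> 1"
      by simp
    moreover have "\<mu> 0 = 1 \<or> \<mu> 0 = - 1" "\<mu> 1 = 1 \<or> \<mu> 1 = - 1"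
      using val[of 0] val[of 1] by auto
    ultimately have n1: "n = 1" and \<mu>1: "\<mu> 1 = - \<mu> 0"
      using sum \<open>n > 0\<close> by auto
    have "\<mu> c = - \<mu> 0" if "0 < c" "c < 4" for c
      using const[of "c - 1"] that \<mu>1 n1 by simp
    then show ?thesis
      using exceptional_meander[of \<mu>] \<open>\<mu> 0 = 1 \<or> \<mu> 0 = - 1\<close> n1 by simp
  qed
qed

text \<open>
  The known characterization of flat foldability: Maekawa's condition is necessary and, for equal
  angles, sufficient.
\<close>

lemma valid_MV_A_iff:
  assumes n: "n > 0"
  shows "valid_MV (A_cp (2 * n)) \<mu> \<longleftrightarrow> \<mu> \<in> MV_assignments (A_cp (2 * n)) \<and>
    ((\<Sum>c<2 * n. \<mu> c) = 2 \<or> (\<Sum>c<2 * n. \<mu> c) = - 2)"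
proof (cases "\<mu> \<in> MV_assignments (A_cp (2 * n))")
  case True
  note val = MV_val[OF True]
  show ?thesis
    unfolding valid_MV_def flat_folding_A_iff[OF n True]
    using True n sum_signs_of_meander[of "2 * n" _ \<mu>] exists_meander[OF n val] by auto
next
  case False
  then show ?thesis by (simp add: valid_MV_def)
qed


section \<open>Counting the edges\<close>

definition mountains :: "nat \<Rightarrow> (nat \<Rightarrow> int) \<Rightarrow> nat set" where
  "mountains N \<mu> = {c. c < N \<and> \<mu> c = 1}"

lemma card_MV_by_mountains:
  "card {\<mu> \<in> MV_assignments (A_cp N). Q (mountains N \<mu>)} = card {P. P \<subseteq> {..<N} \<and> Q P}"
proof (rule bij_betw_same_card)
  let ?g = "\<lambda>P. \<lambda>c\<in>{..<N}. if c \<in> P then 1 else - 1 :: int"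
  have fg: "mountains N (?g P) = P" if "P \<subseteq> {..<N}" for P
    using that by (auto simp: mountains_def)
  have gf: "?g (mountains N \<mu>) = \<mu>" if "\<mu> \<in> MV_assignments (A_cp N)" for \<mu>
  proof
    fix c
    show "?g (mountains N \<mu>) c = \<mu> c"
      using MV_val[OF that, of c] that
      by (auto simp: mountains_def MV_assignments_def PiE_def extensional_def)
  qed
  show "bij_betw (mountains N) {\<mu> \<in> MV_assignments (A_cp N). Q (mountains N \<mu>)}
      {P. P \<subseteq> {..<N} \<and> Q P}"
  proof (rule bij_betw_byWitness[where f' = ?g])
    show "mountains N ` {\<mu> \<in> MV_assignments (A_cp N). Q (mountains N \<mu>)} \<subseteq> {P. P \<subseteq> {..<N} \<and> Q P}"
      by (auto simp: mountains_def)
    show "?g ` {P. P \<subseteq> {..<N} \<and> Q P} \<subseteq> {\<mu> \<in> MV_assignments (A_cp N). Q (mountains N \<mu>)}"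
      using fg by (auto simp: MV_assignments_def split: if_splits)
  qed (use fg gf in auto)
qed

lemma sum_MV_eq:
  assumes "\<mu> \<in> MV_assignments (A_cp N)"
  shows "(\<Sum>c<N. \<mu> c) = 2 * int (card (mountains N \<mu>)) - int N"
proof -
  have "(\<Sum>c<N. \<mu> c) = (\<Sum>c<N. 2 * (if \<mu> c = 1 then 1 else 0) - 1)"
    by (rule sum.cong) (use MV_val[OF assms] in force)+
  also have "\<dots> = 2 * (\<Sum>c<N. if \<mu> c = 1 then 1 else 0) - int N"
    by (simp add: sum_subtractf sum_distrib_left)
  also have "(\<Sum>c<N. if \<mu> c = 1 then 1 else 0) = int (card (mountains N \<mu>))"
    by (simp add: mountains_def sum.If_cases Int_def)
  finally show ?thesis .
qed

lemma sum_flip_face: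
  fixes \<mu> :: "nat \<Rightarrow> int"
  assumes "i < N" "N \<ge> 2"
  shows "(\<Sum>c<N. flip_face (A_cp N) i \<mu> c) = (\<Sum>c<N. \<mu> c) - 2 * \<mu> i - 2 * \<mu> (Suc i mod N)"
proof -
  let ?j = "Suc i mod N"
  have j: "?j < N" "?j \<noteq> i" using assms by (auto simp: mod_Suc)
  have "(\<Sum>c<N. flip_face (A_cp N) i \<mu> c) =
      (\<Sum>c<N. \<mu> c - (if c = i then 2 * \<mu> i else 0) - (if c = ?j then 2 * \<mu> ?j else 0))"
    using j by (intro sum.cong) (auto simp: flip_face_def next_crease_def)
  then show ?thesis using assms(1) j(1) by (simp add: sum_subtractf sum.delta)
qed

lemma flip_face_MV:
  assumes "\<mu> \<in> MV_assignments (A_cp N)" "i < N"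
  shows "flip_face (A_cp N) i \<mu> \<in> MV_assignments (A_cp N)"
proof -
  have "Suc i mod N < N" using assms(2) by simp
  then show ?thesis
    using assms MV_val[OF assms(1,2)] MV_val[OF assms(1), of "Suc i mod N"]
    by (auto simp: MV_assignments_def flip_face_def next_crease_def PiE_def Pi_def extensional_def)
qed

text \<open>
  The two fixed elements are taken away, which leaves \<open>k\<close> elements to be chosen from the rest.
\<close>

lemma card_subsets_separating:
  assumes "finite A" "i \<in> A" "j \<in> A" "i \<noteq> j"
  shows "card {P. P \<subseteq> A \<and> i \<in> P \<and> j \<notin> P \<and> card P = Suc k} = (card A - 2) choose k"
    and "card {P. P \<subseteq> A \<and> i \<in> P \<and> j \<in> P \<and> card P = Suc (Suc k)} = (card A - 2) choose k"
proof -
  let ?R = "A - {i, j}"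
  have fin: "finite ?R" using assms(1) by simp
  have cardR: "card ?R = card A - 2" using assms by (simp add: card_Diff_subset)
  have finS: "finite S" if "S \<subseteq> ?R" for S using that fin finite_subset by blast
  have finP: "finite P" if "P \<subseteq> A" for P using that assms(1) finite_subset by blast
  have "bij_betw (insert i) {S. S \<subseteq> ?R \<and> card S = k}
      {P. P \<subseteq> A \<and> i \<in> P \<and> j \<notin> P \<and> card P = Suc k}"
  proof (rule bij_betw_byWitness[where f' = "\<lambda>P. P - {i}"])
    show "insert i ` {S. S \<subseteq> ?R \<and> card S = k} \<subseteq> {P. P \<subseteq> A \<and> i \<in> P \<and> j \<notin> P \<and> card P = Suc k}"
    proof clarify
      fix S assume S: "S \<subseteq> ?R" "k = card S"
      moreover have "i \<notin> S" "j \<notin> S" using S by auto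
      ultimately show "insert i S \<subseteq> A \<and> i \<in> insert i S \<and> j \<notin> insert i S \<and>
          card (insert i S) = Suc (card S)"
        using assms finS[of S] by auto
    qed
    show "(\<lambda>P. P - {i}) ` {P. P \<subseteq> A \<and> i \<in> P \<and> j \<notin> P \<and> card P = Suc k} \<subseteq>
        {S. S \<subseteq> ?R \<and> card S = k}"
      using finP by auto
  qed auto
  then show "card {P. P \<subseteq> A \<and> i \<in> P \<and> j \<notin> P \<and> card P = Suc k} = (card A - 2) choose k"
    using n_subsets[OF fin, of k] cardR by (simp add: bij_betw_same_card[symmetric])
  have "bij_betw (\<lambda>S. insert i (insert j S)) {S. S \<subseteq> ?R \<and> card S = k}
      {P. P \<subseteq> A \<and> i \<in> P \<and> j \<in> P \<and> card P = Suc (Suc k)}"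
  proof (rule bij_betw_byWitness[where f' = "\<lambda>P. P - {i, j}"])
    show "(\<lambda>S. insert i (insert j S)) ` {S. S \<subseteq> ?R \<and> card S = k} \<subseteq>
        {P. P \<subseteq> A \<and> i \<in> P \<and> j \<in> P \<and> card P = Suc (Suc k)}"
    proof clarify
      fix S assume S: "S \<subseteq> ?R" "k = card S"
      moreover have "i \<notin> S" "j \<notin> S" using S by auto
      ultimately show "insert i (insert j S) \<subseteq> A \<and> i \<in> insert i (insert j S) \<and>
          j \<in> insert i (insert j S) \<and> card (insert i (insert j S)) = Suc (Suc (card S))"
        using assms finS[of S] by auto
    qed
    show "(\<lambda>P. P - {i, j}) ` {P. P \<subseteq> A \<and> i \<in> P \<and> j \<in> P \<and> card P = Suc (Suc k)} \<subseteq>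
        {S. S \<subseteq> ?R \<and> card S = k}"
      using finP assms(4) by (auto simp: card_Diff_subset)
  qed auto
  then show "card {P. P \<subseteq> A \<and> i \<in> P \<and> j \<in> P \<and> card P = Suc (Suc k)} = (card A - 2) choose k"
    using n_subsets[OF fin, of k] cardR by (simp add: bij_betw_same_card[symmetric])
qed

text \<open>
  One end for each edge that flips face \<open>i\<close>: the flip negates crease \<open>i\<close>, so of the two
  ends exactly one has a mountain there.
\<close>

definition flippable_mountain :: "nat \<Rightarrow> nat \<Rightarrow> (nat \<Rightarrow> int) set" where
  "flippable_mountain N i =
     {\<mu>. \<mu> i = 1 \<and> valid_MV (A_cp N) \<mu> \<and> valid_MV (A_cp N) (flip_face (A_cp N) i \<mu>)}"

text \<open>
  An assignment is valid iff it has \<open>n + 1\<close> or \<open>n - 1\<close> mountains. If the second crease of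
  the face is a valley, the flip keeps their number and both values are possible. If it is a mountain,
  the flip removes two, so there are \<open>n + 1\<close> before it.
\<close>

lemma card_flippable_mountain:
  assumes n: "n \<ge> 2" and i: "i < 2 * n"
  shows "card (flippable_mountain (2 * n) i) =
    2 * ((2 * n - 2) choose (n - 2)) + ((2 * n - 2) choose (n - 1))"
proof -
  let ?N = "2 * n"
  let ?j = "Suc i mod ?N"
  have j: "?j < ?N" "i \<noteq> ?j" using n i by (auto simp: mod_Suc)
  let ?Q1 = "\<lambda>P. i \<in> P \<and> ?j \<notin> P \<and> card P = Suc n"
  let ?Q2 = "\<lambda>P. i \<in> P \<and> ?j \<notin> P \<and> card P = Suc (n - 2)"
  let ?Q3 = "\<lambda>P. i \<in> P \<and> ?j \<in> P \<and> card P = Suc (Suc (n - 1))"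
  have "\<mu> \<in> flippable_mountain ?N i \<longleftrightarrow> \<mu> \<in> MV_assignments (A_cp ?N) \<and>
      (?Q1 (mountains ?N \<mu>) \<or> ?Q2 (mountains ?N \<mu>) \<or> ?Q3 (mountains ?N \<mu>))" for \<mu>
  proof (cases "\<mu> \<in> MV_assignments (A_cp ?N)")
    case True
    have mem: "i \<in> mountains ?N \<mu> \<longleftrightarrow> \<mu> i = 1" "?j \<in> mountains ?N \<mu> \<longleftrightarrow> \<mu> ?j = 1"
      using i j by (auto simp: mountains_def)
    have vj: "\<mu> ?j = 1 \<or> \<mu> ?j = - 1" using MV_val[OF True j(1)] .
    have "\<mu> \<in> flippable_mountain ?N i \<longleftrightarrow> \<mu> i = 1 \<and>
        ((\<Sum>c<?N. \<mu> c) = 2 \<or> (\<Sum>c<?N. \<mu> c) = - 2) \<and>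
        ((\<Sum>c<?N. \<mu> c) - 2 * \<mu> i - 2 * \<mu> ?j = 2 \<or> (\<Sum>c<?N. \<mu> c) - 2 * \<mu> i - 2 * \<mu> ?j = - 2)"
      using valid_MV_A_iff[of n \<mu>] valid_MV_A_iff[of n "flip_face (A_cp ?N) i \<mu>"]
        flip_face_MV[OF True i] sum_flip_face[OF i, of \<mu>] n True
      unfolding flippable_mountain_def by auto
    then show ?thesis
      unfolding mem sum_MV_eq[OF True] using True vj n by auto
  next
    case False
    then show ?thesis by (simp add: flippable_mountain_def valid_MV_def)
  qed
  then have "flippable_mountain ?N i = {\<mu> \<in> MV_assignments (A_cp ?N).
      ?Q1 (mountains ?N \<mu>) \<or> ?Q2 (mountains ?N \<mu>) \<or> ?Q3 (mountains ?N \<mu>)}"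
    by blast
  then have "card (flippable_mountain ?N i) = card {P. P \<subseteq> {..<?N} \<and> (?Q1 P \<or> ?Q2 P \<or> ?Q3 P)}"
    using card_MV_by_mountains[of ?N "\<lambda>P. ?Q1 P \<or> ?Q2 P \<or> ?Q3 P"] by simp
  also have "{P. P \<subseteq> {..<?N} \<and> (?Q1 P \<or> ?Q2 P \<or> ?Q3 P)} =
      {P. P \<subseteq> {..<?N} \<and> ?Q1 P} \<union> {P. P \<subseteq> {..<?N} \<and> ?Q2 P} \<union> {P. P \<subseteq> {..<?N} \<and> ?Q3 P}"
    by blast
  also have "card \<dots> = card {P. P \<subseteq> {..<?N} \<and> ?Q1 P} + card {P. P \<subseteq> {..<?N} \<and> ?Q2 P} +
      card {P. P \<subseteq> {..<?N} \<and> ?Q3 P}"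
  proof -
    have fin: "finite {P. P \<subseteq> {..<?N} \<and> Q P}" for Q by simp
    have "{P. P \<subseteq> {..<?N} \<and> ?Q1 P} \<inter> {P. P \<subseteq> {..<?N} \<and> ?Q2 P} = {}"
      using n by fastforce
    moreover have "({P. P \<subseteq> {..<?N} \<and> ?Q1 P} \<union> {P. P \<subseteq> {..<?N} \<and> ?Q2 P}) \<inter>
        {P. P \<subseteq> {..<?N} \<and> ?Q3 P} = {}"
      by blast
    ultimately show ?thesis
      by (simp only: card_Un_disjoint fin finite_UnI)
  qed
  also have "\<dots> = ((?N - 2) choose n) + ((?N - 2) choose (n - 2)) + ((?N - 2) choose (n - 1))"
    using card_subsets_separating(1)[of "{..<?N}" i ?j n]
      card_subsets_separating(1)[of "{..<?N}" i ?j "n - 2"]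
      card_subsets_separating(2)[of "{..<?N}" i ?j "n - 1"] i j
    by simp
  also have "(?N - 2) choose n = (?N - 2) choose (n - 2)"
    using n binomial_symmetric[of n "?N - 2"] by simp
  finally show ?thesis by simp
qed

lemma edges_OFG_A:
  "edges (OFG (A_cp N)) =
    (\<lambda>(i, \<mu>). {\<mu>, flip_face (A_cp N) i \<mu>}) ` (SIGMA i:{..<N}. flippable_mountain N i)"
  (is "?L = ?R")
proof
  show "?R \<subseteq> ?L"
    by (auto simp: OFG_def flippable_mountain_def)
  show "?L \<subseteq> ?R"
  proof
    fix E assume "E \<in> ?L"
    then obtain \<mu> i where E: "E = {\<mu>, flip_face (A_cp N) i \<mu>}" and i: "i < N"
      and v: "valid_MV (A_cp N) \<mu>" "valid_MV (A_cp N) (flip_face (A_cp N) i \<mu>)"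
      by (auto simp: OFG_def)
    have inv: "flip_face (A_cp N) i (flip_face (A_cp N) i \<mu>) = \<mu>"
      by (auto simp: flip_face_def)
    have "\<mu> i = 1 \<or> \<mu> i = - 1" using v(1) MV_val i by (auto simp: valid_MV_def)
    then show "E \<in> ?R"
    proof
      assume "\<mu> i = 1"
      then show ?thesis
        using E i v by (intro image_eqI[of _ _ "(i, \<mu>)"]) (auto simp: flippable_mountain_def)
    next
      assume "\<mu> i = - 1"
      then have "flip_face (A_cp N) i \<mu> i = 1" by (simp add: flip_face_def)
      then show ?thesis
        using E i v inv
        by (intro image_eqI[of _ _ "(i, flip_face (A_cp N) i \<mu>)"]) (auto simp: flippable_mountain_def)
    qed
  qed
qed

text \<open>
  The two ends of an edge differ exactly at the two creases of the flipped face, and with at least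
  three faces these determine the face. The mountain then singles out the end.
\<close>

lemma inj_flip_edge:
  assumes N: "N \<ge> 3"
  shows "inj_on (\<lambda>(i, \<mu>). {\<mu>, flip_face (A_cp N) i \<mu>}) (SIGMA i:{..<N}. flippable_mountain N i)"
proof (rule inj_onI, clarify)
  fix i \<mu> k \<nu>
  assume i: "i < N" "\<mu> \<in> flippable_mountain N i" and k: "k < N" "\<nu> \<in> flippable_mountain N k"
    and eq: "{\<mu>, flip_face (A_cp N) i \<mu>} = {\<nu>, flip_face (A_cp N) k \<nu>}"
  have diff: "{c. c < N \<and> \<rho> c \<noteq> flip_face (A_cp N) l \<rho> c} = {l, Suc l mod N}"
    if "\<rho> \<in> flippable_mountain N l" "l < N" for \<rho> l
  proof -
    have "\<rho> c \<noteq> - \<rho> c" if "c < N" for c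
      using \<open>\<rho> \<in> flippable_mountain N l\<close> MV_val[of \<rho> N c] that
      by (auto simp: flippable_mountain_def valid_MV_def)
    moreover have "Suc l mod N < N" using that by simp
    ultimately show ?thesis using that(2)
      by (auto simp: flip_face_def next_crease_def)
  qed
  have "{c. c < N \<and> \<mu> c \<noteq> flip_face (A_cp N) i \<mu> c} = {c. c < N \<and> \<nu> c \<noteq> flip_face (A_cp N) k \<nu> c}"
    using eq by (auto simp: doubleton_eq_iff)
  then have "{i, Suc i mod N} = {k, Suc k mod N}"
    unfolding diff[OF i(2,1)] diff[OF k(2,1)] .
  then have ik: "i = k"
    using i(1) k(1) N by (auto simp: doubleton_eq_iff mod_Suc split: if_splits)
  moreover have "\<mu> = \<nu>"
  proof (rule ccontr)
    assume "\<mu> \<noteq> \<nu>"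
    then have "\<mu> = flip_face (A_cp N) k \<nu>" using eq by (auto simp: doubleton_eq_iff)
    then have "\<mu> i = - \<nu> i" using ik by (simp add: flip_face_def)
    then show False using i(2) k(2) ik by (simp add: flippable_mountain_def)
  qed
  ultimately show "i = k \<and> \<mu> = \<nu>" by simp
qed

lemma edge_count_closed_form:
  assumes "n \<ge> 2"
  shows "real (2 * n * (2 * ((2 * n - 2) choose (n - 2)) + ((2 * n - 2) choose (n - 1)))) =
    (real n + 1) * (3 * real n - 2) / (2 * real n - 1) * real ((2 * n) choose (n - 1))"
proof -
  obtain m where n: "n = m + 2" using assms by (metis add.commute le_Suc_ex)
  define x where "x = (fact (2 * m + 2) :: real)"
  define y where "y = (fact m :: real)"
  have y: "y \<noteq> 0" by (simp add: y_def)
  have a: "real ((2 * n - 2) choose (n - 2)) = x / (y * ((real m + 2) * (real m + 1) * y))"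
    using binomial_fact[of m "2 * m + 2", where 'a = real] by (simp add: n x_def y_def algebra_simps)
  have b: "real ((2 * n - 2) choose (n - 1)) = x / (((real m + 1) * y) * ((real m + 1) * y))"
    using binomial_fact[of "m + 1" "2 * m + 2", where 'a = real] by (simp add: n x_def y_def algebra_simps)
  have d: "real ((2 * n) choose (n - 1)) = (2 * (real m + 2) * (2 * real m + 3) * x) /
      (((real m + 1) * y) * ((real m + 3) * (real m + 2) * (real m + 1) * y))"
  proof -
    have f: "(fact (2 * m + 4) :: real) = 2 * (real m + 2) * (2 * real m + 3) * x"
      by (simp add: x_def numeral_eq_Suc algebra_simps)
    have g: "(fact (m + 1) :: real) = (real m + 1) * y"
      by (simp add: y_def algebra_simps)
    have h: "(fact (m + 3) :: real) = (real m + 3) * (real m + 2) * (real m + 1) * y"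
      by (simp add: y_def numeral_eq_Suc algebra_simps)
    have nm: "2 * n = 2 * m + 4" "n - 1 = m + 1" "2 * m + 4 - (m + 1) = m + 3"
      by (simp_all add: n)
    show ?thesis
      unfolding nm(1,2) using binomial_fact[of "m + 1" "2 * m + 4", where 'a = real]
      unfolding nm(3) f g h by linarith
  qed
  \<comment> \<open>The identity with \<open>A = m + 1\<close>, \<open>B = m + 2\<close>, \<open>C = m + 3\<close>, \<open>D = 2 m + 3\<close>
    kept as atoms: only \<open>3 n - 2 = 2 A + B\<close> relates them, and all else cancels.\<close>
  have cancel: "2 * B * (2 * (x / (y * (B * A * y))) + x / ((A * y) * (A * y))) =
      C * (2 * A + B) / D * ((2 * B * D * x) / ((A * y) * (C * B * A * y)))"
    if "A \<noteq> 0" "B \<noteq> 0" "C \<noteq> 0" "D \<noteq> 0" for A B C D :: real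
    using that y by (simp add: field_simps)
  have "real (2 * n * (2 * ((2 * n - 2) choose (n - 2)) + ((2 * n - 2) choose (n - 1)))) =
      2 * (real m + 2) * (2 * real ((2 * n - 2) choose (n - 2)) + real ((2 * n - 2) choose (n - 1)))"
    using n by (simp only: of_nat_mult of_nat_add of_nat_numeral)
  also have "\<dots> = (real m + 3) * (2 * (real m + 1) + (real m + 2)) / (2 * real m + 3) *
      real ((2 * n) choose (n - 1))"
    unfolding a b d by (rule cancel) linarith+
  also have "(real m + 3) * (2 * (real m + 1) + (real m + 2)) / (2 * real m + 3) =
      (real n + 1) * (3 * real n - 2) / (2 * real n - 1)"
    by (simp add: n algebra_simps)
  finally show ?thesis .
qed

theorem theorem5p1:
  fixes n :: nat
  assumes "n \<ge> 2"
  shows "real (card (edges (OFG (A_cp (2 * n))))) =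
    (real n + 1) * (3 * real n - 2) / (2 * real n - 1) * real ((2 * n) choose (n - 1))"
proof -
  have fin: "finite (flippable_mountain (2 * n) i)" if "i < 2 * n" for i
  proof (rule finite_subset)
    show "flippable_mountain (2 * n) i \<subseteq> MV_assignments (A_cp (2 * n))"
      by (auto simp: flippable_mountain_def valid_MV_def)
    show "finite (MV_assignments (A_cp (2 * n)))"
      by (auto simp: MV_assignments_def intro: finite_PiE)
  qed
  have "card (edges (OFG (A_cp (2 * n)))) = card (SIGMA i:{..<2 * n}. flippable_mountain (2 * n) i)"
    unfolding edges_OFG_A by (rule card_image, rule inj_flip_edge) (use assms in simp)
  also have "\<dots> = (\<Sum>i<2 * n. card (flippable_mountain (2 * n) i))"
    using fin by (simp add: card_SigmaI)
  also have "\<dots> = 2 * n * (2 * ((2 * n - 2) choose (n - 2)) + ((2 * n - 2) choose (n - 1)))"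
    using card_flippable_mountain[OF assms] by simp
  finally show ?thesis
    using edge_count_closed_form[OF assms] by simp
qed

end
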